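(* Let $K$ be a field, let $I\subset R=K[x_1,\ldots,x_n]$ be a square-free monomial ideal, and let $\sigma$ be a permutation on $\mathrm{supp}(I)$. Then a square-free monomial ideal $J$ is a demotion of the square-free monomial ideal $I$ if and only if $\sigma(J)$ is a demotion of $\sigma(I)$.
   Context: For ideals $J\subseteq I$ in a commutative Noetherian ring $R$, $J$ is a demotion of $I$ if $I^rJ^s=I^{r+s}\cap J^s$ for all integers $r,s\geq 0$ (with $I^0=J^0=R$). For a monomial ideal $I$, $\mathcal{G}(I)$ denotes its unique minimal set of monomial generators, and $\mathrm{supp}(I)$ is the set of variables dividing some element of $\mathcal{G}(I)$. For a square-free monomial ideal $I\subset R$ and a permutation $\sigma$ on $\mathrm{supp}(I)$ (written as acting on the indices of the variables), $\sigma(I)$ is the square-free monomial ideal in $R$ such that $x_{i_1}\cdots x_{i_s}\in\mathcal{G}(I)$ if and only if $x_{\sigma(i_1)}\cdots x_{\sigma(i_s)}\in\mathcal{G}(\sigma(I))$; the notation $\sigma(J)$ is used in the same way for $J$. *)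

theory Defs
  imports
    "HOL-Library.Poly_Mapping"
    "HOL-Combinatorics.Permutations"
    "HOL-Algebra.Ideal_Product"
begin

section \<open>Demotions\<close>

text \<open>
  Powers are taken in \<^term>\<open>ideals_set R\<close>, whose multiplication is the product of ideals and
  whose unit is \<^term>\<open>carrier R\<close>, so the zeroth power of an ideal is the whole ring.
  The ring is meant to be commutative and Noetherian.
\<close>

definition demotion :: "('a, 'b) ring_scheme \<Rightarrow> 'a set \<Rightarrow> 'a set \<Rightarrow> bool" where
  "demotion R J I \<longleftrightarrow>
     ideal I R \<and> ideal J R \<and> J \<subseteq> I \<and>
     (\<forall>r s :: nat.
        ideal_prod R (I [^]\<^bsub>ideals_set R\<^esub> r) (J [^]\<^bsub>ideals_set R\<^esub> s) =
        (I [^]\<^bsub>ideals_set R\<^esub> (r + s)) \<inter> (J [^]\<^bsub>ideals_set R\<^esub> s))"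


section \<open>Monomial ideals in polynomial rings\<close>

text \<open>
  The polynomial ring over \<open>'k\<close> in the variables \<open>x\<^sub>i\<close>, where \<open>i\<close> ranges over the finite
  type \<open>'n\<close>: a polynomial maps exponent vectors to coefficients.
\<close>

type_synonym ('n, 'k) mpoly = "('n \<Rightarrow>\<^sub>0 nat) \<Rightarrow>\<^sub>0 'k"

definition mpoly_ring :: "('n::finite, 'k::field) mpoly ring" where
  "mpoly_ring = \<lparr>carrier = UNIV, monoid.mult = (*), one = 1, ring.zero = 0, add = (+)\<rparr>"

definition monomial :: "('n::finite \<Rightarrow>\<^sub>0 nat) \<Rightarrow> ('n, 'k::field) mpoly" where
  "monomial e = Poly_Mapping.single e 1"

definition Var :: "'n::finite \<Rightarrow> ('n, 'k::field) mpoly" where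
  "Var i = monomial (Poly_Mapping.single i 1)"

definition squarefree_monomial_ideal :: "('n::finite, 'k::field) mpoly set \<Rightarrow> bool" where
  "squarefree_monomial_ideal I \<longleftrightarrow>
     (\<exists>S \<subseteq> {\<Prod>i\<in>A. Var i | A. True}. I = genideal mpoly_ring S)"

definition min_mono_gens :: "('n::finite, 'k::field) mpoly set \<Rightarrow> ('n, 'k) mpoly set \<Rightarrow> bool" where
  "min_mono_gens I G \<longleftrightarrow>
     G \<subseteq> range monomial \<and> genideal mpoly_ring G = I \<and> (\<forall>H \<subset> G. genideal mpoly_ring H \<noteq> I)"

text \<open>Well-defined for monomial ideals by \<open>ex1_min_mono_gens\<close> below.\<close>

definition mingens :: "('n::finite, 'k::field) mpoly set \<Rightarrow> ('n, 'k) mpoly set" where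
  "mingens I = (THE G. min_mono_gens I G)"

definition supp :: "('n::finite, 'k::field) mpoly set \<Rightarrow> 'n set" where
  "supp I = {i. \<exists>m \<in> mingens I. Var i dvd m}"

text \<open>
  A permutation of a set of variables is represented, as in \<^term>\<open>(permutes)\<close>, by a function on
  all variables that is the identity outside that set. This gives \<open>\<sigma>(J)\<close> a meaning for a
  permutation \<open>\<sigma>\<close> of \<open>supp I\<close> even if \<open>J\<close> involves variables outside \<open>supp I\<close>.
  Well-defined for square-free monomial ideals by \<open>ex1_perm_ideal\<close> below.
\<close>

definition perm_ideal :: "('n::finite \<Rightarrow> 'n) \<Rightarrow> ('n, 'k::field) mpoly set \<Rightarrow> ('n, 'k) mpoly set" where
  "perm_ideal \<sigma> I =
     (THE L. squarefree_monomial_ideal L \<and>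
        (\<forall>A. (\<Prod>i\<in>A. Var i) \<in> mingens I \<longleftrightarrow> (\<Prod>i\<in>A. Var (\<sigma> i)) \<in> mingens L))"


section \<open>Well-definedness\<close>

lemma mpoly_ring_simps [simp]:
  "carrier mpoly_ring = UNIV" "monoid.mult mpoly_ring = (*)" "ring.add mpoly_ring = (+)"
  "monoid.one mpoly_ring = 1" "ring.zero mpoly_ring = 0"
  by (auto simp: mpoly_ring_def)

lemma cring_mpoly_ring: "cring (mpoly_ring :: ('n::finite, 'k::field) mpoly ring)"
proof (intro cringI abelian_groupI comm_monoidI)
  show "\<exists>q\<in>carrier mpoly_ring. q \<oplus>\<^bsub>mpoly_ring\<^esub> p = \<zero>\<^bsub>mpoly_ring\<^esub>" for p :: "('n, 'k) mpoly"
    by (auto intro: exI[of _ "- p"])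
qed (auto simp: algebra_simps)

lemma monomial_eq_iff [simp]: "(monomial s :: ('n::finite, 'k::field) mpoly) = monomial t \<longleftrightarrow> s = t"
proof
  assume eq: "(monomial s :: ('n, 'k) mpoly) = monomial t"
  have "Poly_Mapping.keys (monomial s :: ('n, 'k) mpoly) = Poly_Mapping.keys (monomial t :: ('n, 'k) mpoly)"
    by (simp only: eq)
  then show "s = t" by (simp add: monomial_def)
qed simp

lemma ideal_mpoly_ring:
  fixes I :: "('n::finite, 'k::field) mpoly set"
  assumes "ideal I mpoly_ring"
  shows "0 \<in> I" "\<And>p q. p \<in> I \<Longrightarrow> q \<in> I \<Longrightarrow> p + q \<in> I" "\<And>p q. p \<in> I \<Longrightarrow> q * p \<in> I"
proof -
  interpret ideal I mpoly_ring by fact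
  show "0 \<in> I" using additive_subgroup.zero_closed[OF additive_subgroup_axioms] by simp
  show "p + q \<in> I" if "p \<in> I" "q \<in> I" for p q
    using additive_subgroup.a_closed[OF additive_subgroup_axioms] that by simp
  show "q * p \<in> I" if "p \<in> I" for p q using I_l_closed that by simp
qed

lemma ideal_mpoly_ringI:
  fixes I :: "('n::finite, 'k::field) mpoly set"
  assumes z: "0 \<in> I" and a: "\<And>p q. p \<in> I \<Longrightarrow> q \<in> I \<Longrightarrow> p + q \<in> I"
    and m: "\<And>p q. p \<in> I \<Longrightarrow> q * p \<in> I"
  shows "ideal I mpoly_ring"
proof -
  interpret R: cring "mpoly_ring :: ('n, 'k) mpoly ring" by (rule cring_mpoly_ring)
  have neg: "\<ominus>\<^bsub>mpoly_ring\<^esub> p = - p" for p :: "('n, 'k) mpoly"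
    using R.minus_equality[of "- p" p] by simp
  have "- p \<in> I" if "p \<in> I" for p
    using m[OF that, of "-1"] by simp
  then have "subgroup I (add_monoid mpoly_ring)"
    using z a neg by (intro subgroup.intro) (auto simp: a_inv_def)
  then show ?thesis
    using m R.ring_axioms by (intro idealI) (auto simp: mult.commute)
qed

lemma genideal_monomial:
  fixes E :: "('n::finite \<Rightarrow>\<^sub>0 nat) set"
  shows "genideal mpoly_ring (monomial ` E) =
    {p :: ('n, 'k::field) mpoly. \<forall>t \<in> Poly_Mapping.keys p. \<exists>e\<in>E. \<exists>d. t = e + d}" (is "?L = ?R")
proof
  interpret R: cring "mpoly_ring :: ('n, 'k) mpoly ring" by (rule cring_mpoly_ring)
  have "ideal ?R mpoly_ring"
  proof (rule ideal_mpoly_ringI)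
    fix p q :: "('n, 'k) mpoly" assume p: "p \<in> ?R"
    { assume "q \<in> ?R"
      then show "p + q \<in> ?R" using p Poly_Mapping.keys_add[of p q] by blast }
    show "q * p \<in> ?R"
    proof (clarify)
      fix t assume "t \<in> Poly_Mapping.keys (q * p)"
      then obtain a b where "t = a + b" "b \<in> Poly_Mapping.keys p"
        using keys_mult[of q p] by blast
      moreover obtain e d where "e \<in> E" "b = e + d"
        using p \<open>b \<in> Poly_Mapping.keys p\<close> by blast
      ultimately have "t = e + (a + d)" by (simp add: add.left_commute)
      then show "\<exists>e\<in>E. \<exists>d. t = e + d" using \<open>e \<in> E\<close> by blast
    qed
  qed auto
  moreover have "monomial ` E \<subseteq> ?R"
    by (auto simp: monomial_def) (metis add.right_neutral)
  ultimately show "?L \<subseteq> ?R" by (rule R.genideal_minimal)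
  have id: "ideal ?L mpoly_ring" by (rule R.genideal_ideal) simp
  have gen: "monomial ` E \<subseteq> ?L" by (rule R.genideal_self) simp
  show "?R \<subseteq> ?L"
  proof
    fix p assume p: "p \<in> ?R"
    have sum_in: "(\<Sum>t\<in>T. f t) \<in> ?L" if "\<And>t. t \<in> T \<Longrightarrow> f t \<in> ?L"
      for f :: "_ \<Rightarrow> ('n, 'k) mpoly" and T :: "('n \<Rightarrow>\<^sub>0 nat) set"
      using that
    proof (induction T rule: infinite_finite_induct)
      case (insert x F)
      then have "f x \<in> ?L" "(\<Sum>t\<in>F. f t) \<in> ?L" by simp_all
      then show ?case unfolding sum.insert[OF insert.hyps] by (rule ideal_mpoly_ring(2)[OF id])
    qed (simp_all add: ideal_mpoly_ring(1)[OF id])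
    have "(\<Sum>t\<in>Poly_Mapping.keys p. Poly_Mapping.single t (Poly_Mapping.lookup p t)) \<in> ?L"
    proof (rule sum_in)
      fix t assume "t \<in> Poly_Mapping.keys p"
      then obtain e d where ed: "e \<in> E" "t = e + d" using p by blast
      have "Poly_Mapping.single t (Poly_Mapping.lookup p t) =
            Poly_Mapping.single d (Poly_Mapping.lookup p t) * monomial e"
        by (simp add: monomial_def mult_single ed add.commute)
      also have "\<dots> \<in> ?L" using gen ed(1) by (intro ideal_mpoly_ring(3)[OF id]) (rule subsetD, auto)
      finally show "Poly_Mapping.single t (Poly_Mapping.lookup p t) \<in> ?L" .
    qed
    also have "(\<Sum>t\<in>Poly_Mapping.keys p. Poly_Mapping.single t (Poly_Mapping.lookup p t)) = p"
      by (rule poly_mapping_eqI)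
        (auto simp: lookup_sum lookup_single when_def in_keys_iff if_distrib cong: if_cong)
    finally show "p \<in> ?L" .
  qed
qed

lemma monomial_in_genideal:
  "(monomial t :: ('n::finite, 'k::field) mpoly) \<in> genideal mpoly_ring (monomial ` E) \<longleftrightarrow>
    (\<exists>e\<in>E. \<exists>d. t = e + d)"
  unfolding genideal_monomial by (simp add: monomial_def)

definition min_exps :: "('n::finite \<Rightarrow>\<^sub>0 nat) set \<Rightarrow> ('n \<Rightarrow>\<^sub>0 nat) set" where
  "min_exps E = {t \<in> E. \<forall>s\<in>E. \<forall>d. t = s + d \<longrightarrow> s = t}"

lemma ex_min_exps:
  assumes "t \<in> E"
  shows "\<exists>e\<in>min_exps E. \<exists>d. t = e + d"
  using assms
proof (induction "\<Sum>i\<in>UNIV. Poly_Mapping.lookup t i" arbitrary: t rule: less_induct)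
  case less
  show ?case
  proof (cases "t \<in> min_exps E")
    case True
    then show ?thesis by (metis add.right_neutral)
  next
    case False
    then obtain s d where s: "s \<in> E" "t = s + d" "s \<noteq> t"
      using less.prems unfolding min_exps_def by blast
    then have "d \<noteq> 0" by auto
    then obtain i where "Poly_Mapping.lookup d i \<noteq> 0"
      by (metis lookup_zero poly_mapping_eqI)
    then have "0 < (\<Sum>i\<in>UNIV. Poly_Mapping.lookup d i)"
      by (metis UNIV_I finite gr0I sum_eq_0_iff)
    then have "(\<Sum>i\<in>UNIV. Poly_Mapping.lookup s i) < (\<Sum>i\<in>UNIV. Poly_Mapping.lookup t i)"
      by (simp add: s lookup_add sum.distrib)
    then obtain e d' where e: "e \<in> min_exps E" "s = e + d'" using less.hyps s(1) by blast
    then have "t = e + (d' + d)" using s(2) by (simp add: add.assoc)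
    then show ?thesis using e(1) by blast
  qed
qed

lemma genideal_min_exps:
  fixes E :: "('n::finite \<Rightarrow>\<^sub>0 nat) set"
  shows "genideal mpoly_ring (monomial ` min_exps E) =
    (genideal mpoly_ring (monomial ` E) :: ('n, 'k::field) mpoly set)"
proof -
  have "(\<exists>e\<in>min_exps E. \<exists>d. t = e + d) \<longleftrightarrow> (\<exists>e\<in>E. \<exists>d. t = e + d)" for t
  proof
    show "\<exists>e\<in>min_exps E. \<exists>d. t = e + d \<Longrightarrow> \<exists>e\<in>E. \<exists>d. t = e + d"
      unfolding min_exps_def by blast
    assume "\<exists>e\<in>E. \<exists>d. t = e + d"
    then obtain s d where s: "s \<in> E" "t = s + d" by blast
    obtain e d' where e: "e \<in> min_exps E" "s = e + d'" using ex_min_exps[OF s(1)] by blast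
    then have "t = e + (d' + d)" using s(2) by (simp add: add.assoc)
    then show "\<exists>e\<in>min_exps E. \<exists>d. t = e + d" using e(1) by blast
  qed
  then show ?thesis by (simp add: genideal_monomial)
qed

lemma min_exps_subset:
  fixes E F :: "('n::finite \<Rightarrow>\<^sub>0 nat) set"
  assumes "genideal mpoly_ring (monomial ` F) =
    (genideal mpoly_ring (monomial ` E) :: ('n, 'k::field) mpoly set)"
  shows "min_exps E \<subseteq> F"
proof
  fix t assume t: "t \<in> min_exps E"
  have *: "(\<exists>e\<in>F. \<exists>d. s = e + d) \<longleftrightarrow> (\<exists>e\<in>E. \<exists>d. s = e + d)" for s
    using assms monomial_in_genideal[where 'k = 'k] by metis
  have "t = t + 0" "t \<in> E" using t by (auto simp: min_exps_def)
  then obtain f d where f: "f \<in> F" "t = f + d" using * by metis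
  then obtain e d' where e: "e \<in> E" "f = e + d'" using * by (metis add.right_neutral)
  have "t = e + (d' + d)" using f e by (simp add: add.assoc)
  then have "e = t" using t e unfolding min_exps_def by blast
  then have "d' + d = 0" using \<open>t = e + (d' + d)\<close> by simp
  then have "d = 0"
    by (metis add_is_0 lookup_add lookup_zero poly_mapping_eqI)
  then show "t \<in> F" using f by simp
qed

lemma min_mono_gens_iff:
  fixes E :: "('n::finite \<Rightarrow>\<^sub>0 nat) set"
  shows "min_mono_gens (genideal mpoly_ring (monomial ` E)) G \<longleftrightarrow>
    G = (monomial ` min_exps E :: ('n, 'k::field) mpoly set)"
proof
  assume G: "min_mono_gens (genideal mpoly_ring (monomial ` E)) G"
  then obtain F where F: "G = monomial ` F"
    unfolding min_mono_gens_def subset_image_iff by blast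
  have "monomial ` min_exps E \<subseteq> G"
    using G min_exps_subset[of F E, where 'k = 'k] unfolding F min_mono_gens_def by blast
  then show "G = monomial ` min_exps E"
    using G genideal_min_exps[of E, where 'k = 'k] unfolding min_mono_gens_def by blast
next
  assume G: "G = monomial ` min_exps E"
  have "genideal mpoly_ring H \<noteq> genideal mpoly_ring (monomial ` E)" if H: "H \<subset> G" for H
  proof
    assume eq: "genideal mpoly_ring H = genideal mpoly_ring (monomial ` E)"
    obtain F where F: "H = monomial ` F" using H unfolding G psubset_eq subset_image_iff by blast
    have "min_exps E \<subseteq> F" using min_exps_subset[of F E] eq unfolding F by blast
    then have "G \<subseteq> H" unfolding F G by blast
    with H show False by blast
  qed
  then show "min_mono_gens (genideal mpoly_ring (monomial ` E)) G"
    using genideal_min_exps[of E, where 'k = 'k] unfolding min_mono_gens_def G by blast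
qed

lemma ex1_min_mono_gens:
  fixes S :: "('n::finite, 'k::field) mpoly set"
  assumes "S \<subseteq> range monomial"
  shows "\<exists>!G. min_mono_gens (genideal mpoly_ring S) G"
proof -
  obtain E where "S = monomial ` E" using assms unfolding subset_image_iff by blast
  then show ?thesis by (simp add: min_mono_gens_iff)
qed

lemma mingens_genideal:
  fixes E :: "('n::finite \<Rightarrow>\<^sub>0 nat) set"
  shows "mingens (genideal mpoly_ring (monomial ` E)) =
    (monomial ` min_exps E :: ('n, 'k::field) mpoly set)"
  unfolding mingens_def by (rule the_equality) (simp_all add: min_mono_gens_iff)

definition sqf_exp :: "'n::finite set \<Rightarrow> ('n \<Rightarrow>\<^sub>0 nat)" where
  "sqf_exp A = (\<Sum>i\<in>A. Poly_Mapping.single i 1)"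

lemma lookup_sqf_exp: "Poly_Mapping.lookup (sqf_exp A) i = (if i \<in> A then 1 else 0)"
  by (simp add: sqf_exp_def lookup_sum lookup_single when_def)

lemma sqf_exp_eq_iff [simp]: "sqf_exp A = sqf_exp B \<longleftrightarrow> A = B"
proof
  assume eq: "sqf_exp A = sqf_exp B"
  have "i \<in> A \<longleftrightarrow> i \<in> B" for i
    using arg_cong[OF eq, of "\<lambda>e. Poly_Mapping.lookup e i"]
    by (simp add: lookup_sqf_exp split: if_splits)
  then show "A = B" by blast
qed simp

lemma sqf_exp_dvd_iff: "(\<exists>d. sqf_exp B = sqf_exp A + d) \<longleftrightarrow> A \<subseteq> B"
proof
  assume "\<exists>d. sqf_exp B = sqf_exp A + d"
  then obtain d where d: "sqf_exp B = sqf_exp A + d" ..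
  show "A \<subseteq> B"
  proof
    fix i assume "i \<in> A"
    then show "i \<in> B" using arg_cong[OF d, of "\<lambda>e. Poly_Mapping.lookup e i"]
      by (simp add: lookup_sqf_exp lookup_add split: if_splits)
  qed
next
  assume "A \<subseteq> B"
  then have "sqf_exp B = sqf_exp A + sqf_exp (B - A)"
    by (auto intro!: poly_mapping_eqI simp: lookup_sqf_exp lookup_add)
  then show "\<exists>d. sqf_exp B = sqf_exp A + d" ..
qed

lemma prod_Var: "(\<Prod>i\<in>A. Var i) = (monomial (sqf_exp A) :: ('n::finite, 'k::field) mpoly)"
proof -
  have "finite A" by simp
  then show ?thesis
    by (induction A rule: finite_induct)
      (auto simp: sqf_exp_def Var_def monomial_def mult_single)
qed

lemma prod_Var_permuted:
  assumes "inj \<sigma>"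
  shows "(\<Prod>i\<in>A. Var (\<sigma> i)) = (monomial (sqf_exp (\<sigma> ` A)) :: ('n::finite, 'k::field) mpoly)"
  unfolding prod_Var[symmetric] by (subst prod.reindex) (use assms in \<open>auto intro: inj_on_subset\<close>)

lemma squarefree_monomial_idealE:
  fixes I :: "('n::finite, 'k::field) mpoly set"
  assumes "squarefree_monomial_ideal I"
  obtains \<A> where "I = genideal mpoly_ring (monomial ` sqf_exp ` \<A>)"
    "mingens I = monomial ` sqf_exp ` \<A>" "\<And>A B. A \<in> \<A> \<Longrightarrow> B \<in> \<A> \<Longrightarrow> A \<subseteq> B \<Longrightarrow> A = B"
proof -
  obtain S where S: "S \<subseteq> {\<Prod>i\<in>A. Var i | A. True}" "I = genideal mpoly_ring S"
    using assms unfolding squarefree_monomial_ideal_def by blast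
  define \<B> where "\<B> = {A. monomial (sqf_exp A) \<in> S}"
  have SB: "S = monomial ` sqf_exp ` \<B>" using S unfolding \<B>_def prod_Var by auto
  have "min_exps (sqf_exp ` \<B>) \<subseteq> sqf_exp ` \<B>" unfolding min_exps_def by blast
  then obtain \<A> where A: "min_exps (sqf_exp ` \<B>) = sqf_exp ` \<A>"
    unfolding subset_image_iff by blast
  have "I = genideal mpoly_ring (monomial ` sqf_exp ` \<A>)"
    using genideal_min_exps[of "sqf_exp ` \<B>", where 'k = 'k] unfolding S SB A by simp
  moreover have "mingens I = monomial ` sqf_exp ` \<A>"
    unfolding S SB mingens_genideal A by simp
  moreover have "A = B" if AB: "A \<in> \<A>" "B \<in> \<A>" "A \<subseteq> B" for A B
  proof -
    have "sqf_exp A \<in> sqf_exp ` \<B>" "sqf_exp B \<in> min_exps (sqf_exp ` \<B>)"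
      using AB A unfolding min_exps_def by blast+
    moreover obtain d where "sqf_exp B = sqf_exp A + d" using AB(3) sqf_exp_dvd_iff by blast
    ultimately have "sqf_exp A = sqf_exp B" unfolding min_exps_def by blast
    then show ?thesis by simp
  qed
  ultimately show thesis by (rule that)
qed

lemma mingens_antichain:
  assumes "\<And>A B. A \<in> \<A> \<Longrightarrow> B \<in> \<A> \<Longrightarrow> A \<subseteq> B \<Longrightarrow> A = B"
  shows "mingens (genideal mpoly_ring (monomial ` sqf_exp ` \<A>)) =
    (monomial ` sqf_exp ` \<A> :: ('n::finite, 'k::field) mpoly set)"
proof -
  have "sqf_exp A = sqf_exp B" if "A \<in> \<A>" "B \<in> \<A>" "sqf_exp B = sqf_exp A + d" for A B d
    using assms[OF that(1,2)] that(3) sqf_exp_dvd_iff[of B A] by auto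
  then have "min_exps (sqf_exp ` \<A>) = sqf_exp ` \<A>"
    unfolding min_exps_def by auto
  then show ?thesis by (simp add: mingens_genideal)
qed

lemma ex1_perm_ideal:
  fixes I :: "('n::finite, 'k::field) mpoly set"
  assumes I: "squarefree_monomial_ideal I" and \<sigma>: "\<sigma> permutes V"
  shows "\<exists>!L :: ('n, 'k) mpoly set. squarefree_monomial_ideal L \<and>
    (\<forall>A. (\<Prod>i\<in>A. Var i) \<in> mingens I \<longleftrightarrow> (\<Prod>i\<in>A. Var (\<sigma> i)) \<in> mingens L)"
    (is "\<exists>!L. ?P L")
proof -
  have inj: "inj \<sigma>" using \<sigma> by (rule permutes_inj)
  have surj: "\<exists>A. B = \<sigma> ` A" for B
    using permutes_surj[OF \<sigma>] by (metis subset_imageE top_greatest)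
  obtain \<A> where A: "mingens I = monomial ` sqf_exp ` \<A>"
    "\<And>A B. A \<in> \<A> \<Longrightarrow> B \<in> \<A> \<Longrightarrow> A \<subseteq> B \<Longrightarrow> A = B"
    using squarefree_monomial_idealE[OF I] by metis
  have mem: "(monomial (sqf_exp A) :: ('n, 'k) mpoly) \<in> monomial ` sqf_exp ` \<C> \<longleftrightarrow> A \<in> \<C>" for A \<C>
    by (auto simp: image_iff)
  have P: "squarefree_monomial_ideal L \<and> (\<forall>A. A \<in> \<A> \<longleftrightarrow> monomial (sqf_exp (\<sigma> ` A)) \<in> mingens L)
    \<longleftrightarrow> ?P L" for L
    by (simp only: A(1) prod_Var prod_Var_permuted[OF inj] mem)
  let ?L = "genideal mpoly_ring (monomial ` sqf_exp ` (image \<sigma> ` \<A>)) :: ('n, 'k) mpoly set"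
  have m: "mingens ?L = monomial ` sqf_exp ` (image \<sigma> ` \<A>)"
  proof (rule mingens_antichain)
    fix B C assume "B \<in> image \<sigma> ` \<A>" "C \<in> image \<sigma> ` \<A>" and BC: "B \<subseteq> C"
    then obtain B' C' where *: "B' \<in> \<A>" "B = \<sigma> ` B'" "C' \<in> \<A>" "C = \<sigma> ` C'" by blast
    then have "B' \<subseteq> C'" using BC inj_image_subset_iff[OF inj] by simp
    then have "B' = C'" using A(2) *(1,3) by blast
    then show "B = C" using * by simp
  qed
  have "squarefree_monomial_ideal ?L"
    unfolding squarefree_monomial_ideal_def prod_Var
    by (rule exI[of _ "monomial ` sqf_exp ` (image \<sigma> ` \<A>)"]) auto
  moreover have "A \<in> \<A> \<longleftrightarrow> monomial (sqf_exp (\<sigma> ` A)) \<in> mingens ?L" for A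
    unfolding m mem by (auto simp: image_iff inj_image_eq_iff[OF inj])
  ultimately have "?P ?L" by (intro P[THEN iffD1] conjI allI)
  moreover have "L = ?L" if "?P L" for L
  proof -
    have L: "squarefree_monomial_ideal L" "\<And>A. A \<in> \<A> \<longleftrightarrow> monomial (sqf_exp (\<sigma> ` A)) \<in> mingens L"
      using iffD2[OF P that] by simp_all
    obtain \<B> where B: "L = genideal mpoly_ring (monomial ` sqf_exp ` \<B>)"
      "mingens L = monomial ` sqf_exp ` \<B>"
      using squarefree_monomial_idealE[OF L(1)] by metis
    have AB: "A \<in> \<A> \<longleftrightarrow> \<sigma> ` A \<in> \<B>" for A using L(2) unfolding B(2) mem .
    have "B \<in> \<B> \<longleftrightarrow> B \<in> image \<sigma> ` \<A>" for B
    proof -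
      obtain A where A: "B = \<sigma> ` A" using surj by blast
      show ?thesis unfolding A AB[symmetric] by (auto simp: image_iff inj_image_eq_iff[OF inj])
    qed
    then have "\<B> = image \<sigma> ` \<A>" by blast
    then show ?thesis using B by simp
  qed
  ultimately show ?thesis by (rule ex1I)
qed

end

theory Submission
  imports Defs "HOL-Algebra.QuotRing"
begin

text \<open>
  The permutation \<open>\<sigma>\<close> of the variables extends to an automorphism \<open>\<phi>\<close> of the polynomial ring,
  sending \<open>x\<^sub>i\<close> to the variable with index \<open>\<sigma> i\<close>. Being a demotion is expressed through sums,
  products, inclusions and intersections only, so it is invariant under ring isomorphisms
  (\<open>demotion_ring_iso_iff\<close>). It remains to recognise \<open>\<sigma>(I)\<close>, which is characterised through
  minimal generators, as the image \<open>\<phi>(I)\<close> (\<open>perm_ideal_eq_image\<close>): \<open>\<phi>\<close> carries the minimal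
  generating set of \<open>I\<close>, an antichain of square-free monomials, to such an antichain, which
  generates \<open>\<phi>(I)\<close> and is therefore its minimal generating set.

  A permutation of \<open>supp I\<close>, extended by the identity, is a bijection on all variables, so \<open>\<phi>\<close>
  acts on the whole ring and the same \<open>\<phi>\<close> serves for \<open>I\<close> and for \<open>J\<close>.
\<close>


section \<open>Transport of ideals along ring isomorphisms\<close>

lemma ring_iso_ring_homD: "h \<in> ring_iso R S \<Longrightarrow> h \<in> ring_hom R S"
  by (simp add: ring_iso_def)

lemma ring_iso_inj_on: "h \<in> ring_iso R S \<Longrightarrow> inj_on h (carrier R)"
  by (simp add: ring_iso_def bij_betw_def)

lemma ring_iso_surj: "h \<in> ring_iso R S \<Longrightarrow> h ` carrier R = carrier S"
  by (simp add: ring_iso_def bij_betw_def)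

lemma inv_into_image_ring_iso:
  assumes "h \<in> ring_iso R S" "A \<subseteq> carrier R"
  shows "inv_into (carrier R) h ` h ` A = A"
  using inv_into_image_cancel[OF ring_iso_inj_on[OF assms(1)] assms(2)] .

lemma image_ideal_ring_iso:
  assumes R: "ring R" and S: "ring S" and h: "h \<in> ring_iso R S" and I: "ideal I R"
  shows "ideal (h ` I) S"
proof -
  \<comment> \<open>The image is the preimage under the inverse isomorphism.\<close>
  let ?g = "inv_into (carrier R) h"
  have g: "?g \<in> ring_iso S R" by (rule ring_iso_set_sym[OF R h])
  interpret G: ring_hom_ring S R ?g
    by (rule ring_hom_ringI2[OF S R ring_iso_ring_homD[OF g]])
  have sub: "I \<subseteq> carrier R" using ideal.Icarr[OF I] by blast
  have "h ` I = {s \<in> carrier S. ?g s \<in> I}"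
  proof (intro equalityI subsetI)
    fix s assume "s \<in> h ` I"
    then show "s \<in> {s \<in> carrier S. ?g s \<in> I}"
      using sub ring_iso_surj[OF h] inv_into_f_f[OF ring_iso_inj_on[OF h]] by auto
  next
    fix s assume s: "s \<in> {s \<in> carrier S. ?g s \<in> I}"
    then have "h (?g s) = s" using ring_iso_surj[OF h] by (intro f_inv_into_f) auto
    then show "s \<in> h ` I" using s by (metis (mono_tags, lifting) imageI mem_Collect_eq)
  qed
  then show ?thesis using G.ideal_vimage[OF I] by simp
qed

lemma image_genideal_ring_iso:
  assumes R: "ring R" and S: "ring S" and h: "h \<in> ring_iso R S" and X: "X \<subseteq> carrier R"
  shows "h ` genideal R X = genideal S (h ` X)"
proof
  let ?g = "inv_into (carrier R) h"
  have g: "?g \<in> ring_iso S R" by (rule ring_iso_set_sym[OF R h])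
  have hX: "h ` X \<subseteq> carrier S" using X ring_iso_surj[OF h] by blast
  have idX: "ideal (genideal R X) R" by (rule ring.genideal_ideal[OF R X])
  show "genideal S (h ` X) \<subseteq> h ` genideal R X"
    by (intro ring.genideal_minimal[OF S] image_ideal_ring_iso[OF R S h idX] image_mono
        ring.genideal_self[OF R X])
  have idhX: "ideal (genideal S (h ` X)) S" by (rule ring.genideal_ideal[OF S hX])
  have "?g ` h ` X \<subseteq> ?g ` genideal S (h ` X)"
    by (intro image_mono ring.genideal_self[OF S hX])
  then have "genideal R X \<subseteq> ?g ` genideal S (h ` X)"
    unfolding inv_into_image_ring_iso[OF h X]
    by (rule ring.genideal_minimal[OF R image_ideal_ring_iso[OF S R g idhX]])
  then have "h ` genideal R X \<subseteq> h ` ?g ` genideal S (h ` X)" by (rule image_mono)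
  also have "\<dots> = genideal S (h ` X)"
    using ideal.Icarr[OF idhX] by (intro image_inv_into_cancel[OF ring_iso_surj[OF h]]) blast
  finally show "h ` genideal R X \<subseteq> genideal S (h ` X)" .
qed

lemma ideal_prod_subset_carrier:
  assumes "ring R" "A \<subseteq> carrier R" "B \<subseteq> carrier R"
  shows "ideal_prod R A B \<subseteq> carrier R"
proof
  interpret ring R by fact
  fix x assume "x \<in> ideal_prod R A B"
  then show "x \<in> carrier R" using assms(2,3) by induction auto
qed

lemma image_ideal_prod:
  assumes R: "ring R" and h: "h \<in> ring_hom R S" and A: "A \<subseteq> carrier R" and B: "B \<subseteq> carrier R"
  shows "h ` ideal_prod R A B = ideal_prod S (h ` A) (h ` B)"
proof (intro equalityI subsetI)
  have carr: "x \<in> carrier R" if "x \<in> ideal_prod R A B" for x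
    using ideal_prod_subset_carrier[OF R A B] that by blast
  fix y
  { assume "y \<in> h ` ideal_prod R A B"
    then obtain x where x: "x \<in> ideal_prod R A B" "y = h x" by blast
    from x(1) have "h x \<in> ideal_prod S (h ` A) (h ` B)"
    proof induction
      case (prod a b)
      then have "h (a \<otimes>\<^bsub>R\<^esub> b) = h a \<otimes>\<^bsub>S\<^esub> h b"
        using A B by (intro ring_hom_mult[OF h]) auto
      then show ?case using prod by (simp add: ideal_prod.prod)
    next
      case (sum a b)
      then show ?case
        using ring_hom_add[OF h carr carr] by (simp add: ideal_prod.sum)
    qed
    then show "y \<in> ideal_prod S (h ` A) (h ` B)" using x(2) by simp }
  { assume "y \<in> ideal_prod S (h ` A) (h ` B)"
    then show "y \<in> h ` ideal_prod R A B"
    proof induction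
      case (prod a b)
      then obtain a' b' where ab: "a' \<in> A" "a = h a'" "b' \<in> B" "b = h b'" by blast
      then have "a \<otimes>\<^bsub>S\<^esub> b = h (a' \<otimes>\<^bsub>R\<^esub> b')"
        using ring_hom_mult[OF h subsetD[OF A ab(1)] subsetD[OF B ab(3)]] by simp
      then show ?case using ideal_prod.prod[of a' A b' B R] ab by simp
    next
      case (sum a b)
      then obtain a' b' where ab: "a' \<in> ideal_prod R A B" "a = h a'"
        "b' \<in> ideal_prod R A B" "b = h b'" by blast
      then have "a \<oplus>\<^bsub>S\<^esub> b = h (a' \<oplus>\<^bsub>R\<^esub> b')"
        using ring_hom_add[OF h carr carr] by simp
      then show ?case using ideal_prod.sum[OF ab(1,3)] by simp
    qed }
qed

lemma ideals_set_pow_0: "A [^]\<^bsub>ideals_set R\<^esub> (0::nat) = carrier R"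
  by (simp add: nat_pow_def ideals_set_def)

lemma ideals_set_pow_Suc:
  "A [^]\<^bsub>ideals_set R\<^esub> Suc n = ideal_prod R (A [^]\<^bsub>ideals_set R\<^esub> n) A"
  by (simp add: nat_pow_def ideals_set_def)

lemma ideals_set_pow_subset_carrier:
  fixes n :: nat
  assumes "ring R" "A \<subseteq> carrier R"
  shows "A [^]\<^bsub>ideals_set R\<^esub> n \<subseteq> carrier R"
proof (induction n)
  case 0
  show ?case unfolding ideals_set_pow_0 ..
next
  case (Suc n)
  show ?case unfolding ideals_set_pow_Suc by (rule ideal_prod_subset_carrier[OF assms(1) Suc assms(2)])
qed

text \<open>
  Surjectivity is what makes the zeroth powers, the whole rings, correspond.
\<close>

lemma image_ideals_set_pow:
  fixes n :: nat
  assumes R: "ring R" and h: "h \<in> ring_iso R S" and A: "A \<subseteq> carrier R"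
  shows "h ` (A [^]\<^bsub>ideals_set R\<^esub> n) = (h ` A) [^]\<^bsub>ideals_set S\<^esub> n"
proof (induction n)
  case 0
  show ?case unfolding ideals_set_pow_0 by (rule ring_iso_surj[OF h])
next
  case (Suc n)
  show ?case
    unfolding ideals_set_pow_Suc Suc.IH[symmetric]
    by (intro image_ideal_prod[OF R ring_iso_ring_homD[OF h]]
        ideals_set_pow_subset_carrier[OF R A] A)
qed

lemma demotion_image_ring_iso:
  assumes R: "ring R" and S: "ring S" and h: "h \<in> ring_iso R S" and dem: "demotion R J I"
  shows "demotion S (h ` J) (h ` I)"
  unfolding demotion_def
proof (intro conjI allI)
  have I: "ideal I R" and J: "ideal J R" and JI: "J \<subseteq> I"
    and eq: "\<And>r s :: nat.
      ideal_prod R (I [^]\<^bsub>ideals_set R\<^esub> r) (J [^]\<^bsub>ideals_set R\<^esub> s) =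
      (I [^]\<^bsub>ideals_set R\<^esub> (r + s)) \<inter> (J [^]\<^bsub>ideals_set R\<^esub> s)"
    using dem unfolding demotion_def by simp_all
  have sub: "I \<subseteq> carrier R" "J \<subseteq> carrier R" using ideal.Icarr[OF I] ideal.Icarr[OF J] by blast+
  note pow_sub = ideals_set_pow_subset_carrier[OF R sub(1)] ideals_set_pow_subset_carrier[OF R sub(2)]
  show "ideal (h ` I) S" "ideal (h ` J) S" by (rule image_ideal_ring_iso[OF R S h], fact)+
  show "h ` J \<subseteq> h ` I" using JI by (rule image_mono)
  fix r s :: nat
  show "ideal_prod S ((h ` I) [^]\<^bsub>ideals_set S\<^esub> r) ((h ` J) [^]\<^bsub>ideals_set S\<^esub> s) =
    ((h ` I) [^]\<^bsub>ideals_set S\<^esub> (r + s)) \<inter> ((h ` J) [^]\<^bsub>ideals_set S\<^esub> s)"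
    unfolding image_ideals_set_pow[OF R h sub(1), symmetric]
      image_ideals_set_pow[OF R h sub(2), symmetric]
      image_ideal_prod[OF R ring_iso_ring_homD[OF h] pow_sub, symmetric] eq
    by (rule inj_on_image_Int[OF ring_iso_inj_on[OF h] pow_sub])
qed

text \<open>
  Values of \<open>h\<close> outside the carrier are arbitrary, so a set that is not contained in the carrier
  could be mapped onto an ideal; the inclusions exclude this.
\<close>

lemma demotion_ring_iso_iff:
  assumes R: "ring R" and S: "ring S" and h: "h \<in> ring_iso R S"
    and I: "I \<subseteq> carrier R" and J: "J \<subseteq> carrier R"
  shows "demotion R J I \<longleftrightarrow> demotion S (h ` J) (h ` I)"
  using demotion_image_ring_iso[OF R S h, of J I]
    demotion_image_ring_iso[OF S R ring_iso_set_sym[OF R h], of "h ` J" "h ` I"]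
  unfolding inv_into_image_ring_iso[OF h I] inv_into_image_ring_iso[OF h J] by blast


section \<open>Renaming variables\<close>

text \<open>
  The substitution \<open>x\<^sub>i \<mapsto> x\<^bsub>\<sigma> i\<^esub>\<close>: the coefficient of the result at an exponent vector
  \<open>e\<close> is the coefficient of \<open>p\<close> at \<open>e \<circ> \<sigma>\<close>. The library function \<open>map_key\<close> is meaningful for
  injective key maps, so \<open>\<sigma>\<close> is meant to be bijective.
\<close>

definition rename_vars :: "('n::finite \<Rightarrow> 'n) \<Rightarrow> ('n, 'k::field) mpoly \<Rightarrow> ('n, 'k) mpoly" where
  "rename_vars \<sigma> = Poly_Mapping.map_key (Poly_Mapping.map_key \<sigma>)"

lemma map_key_inverse:
  assumes "bij \<sigma>"
  shows "Poly_Mapping.map_key \<sigma> (Poly_Mapping.map_key (inv_into UNIV \<sigma>) e) = e"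
    and "Poly_Mapping.map_key (inv_into UNIV \<sigma>) (Poly_Mapping.map_key \<sigma> e') = e'"
proof -
  have inj: "inj \<sigma>" "inj (inv_into UNIV \<sigma>)"
    using assms by (auto intro: bij_is_inj bij_imp_bij_inv)
  have comp: "inv_into UNIV \<sigma> \<circ> \<sigma> = (\<lambda>x. x)" "\<sigma> \<circ> inv_into UNIV \<sigma> = (\<lambda>x. x)"
    using inv_f_f[OF inj(1)] surj_f_inv_f[OF bij_is_surj[OF assms]] by (simp_all add: fun_eq_iff)
  show "Poly_Mapping.map_key \<sigma> (Poly_Mapping.map_key (inv_into UNIV \<sigma>) e) = e"
    unfolding map_key_compose[OF inj] comp by (rule map_key_id)
  show "Poly_Mapping.map_key (inv_into UNIV \<sigma>) (Poly_Mapping.map_key \<sigma> e') = e'"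
    unfolding map_key_compose[OF inj(2,1)] comp by (rule map_key_id)
qed

lemma bij_map_key:
  assumes "bij \<sigma>"
  shows "bij (Poly_Mapping.map_key \<sigma>)"
  by (rule bijI') (metis map_key_inverse[OF assms])+

lemma bij_rename_vars: "bij \<sigma> \<Longrightarrow> bij (rename_vars \<sigma>)"
  unfolding rename_vars_def by (intro bij_map_key)

lemma rename_vars_add:
  "bij \<sigma> \<Longrightarrow> rename_vars \<sigma> (p + q) = rename_vars \<sigma> p + rename_vars \<sigma> q"
  unfolding rename_vars_def by (rule map_key_plus) (intro bij_is_inj bij_map_key)

text \<open>
  The coefficients of a product are sums over pairs of exponent vectors, and \<open>e \<mapsto> e \<circ> \<sigma>\<close> is an
  additive bijection, by which both summation indices can be substituted.
\<close>

lemma rename_vars_mult: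
  fixes p q :: "('n::finite, 'k::field) mpoly"
  assumes \<sigma>: "bij \<sigma>"
  shows "rename_vars \<sigma> (p * q) = rename_vars \<sigma> p * rename_vars \<sigma> q"
proof (rule poly_mapping_eqI)
  let ?F = "Poly_Mapping.map_key \<sigma> :: ('n \<Rightarrow>\<^sub>0 nat) \<Rightarrow> ('n \<Rightarrow>\<^sub>0 nat)"
  have F: "bij ?F" by (rule bij_map_key[OF \<sigma>])
  have lookup: "Poly_Mapping.lookup (rename_vars \<sigma> r) e = Poly_Mapping.lookup r (?F e)"
    for r :: "('n, 'k) mpoly" and e
    using bij_is_inj[OF F] by (simp add: rename_vars_def map_key.rep_eq)
  have index: "?F e = ?F a + ?F b \<longleftrightarrow> e = a + b" for e a b
    using bij_is_inj[OF F] by (simp add: map_key_plus[OF bij_is_inj[OF \<sigma>], symmetric] inj_eq)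
  fix e
  have "Poly_Mapping.lookup (p * q) (?F e) =
    (\<Sum>a. Poly_Mapping.lookup p a * (\<Sum>b. Poly_Mapping.lookup q b when ?F e = a + b))"
    by (rule lookup_mult)
  also have "\<dots> = (\<Sum>a. Poly_Mapping.lookup p (?F a) *
      (\<Sum>b. Poly_Mapping.lookup q b when ?F e = ?F a + b))"
    by (rule Sum_any.reindex_cong[OF F]) (simp add: fun_eq_iff)
  also have "\<dots> = (\<Sum>a. Poly_Mapping.lookup p (?F a) *
      (\<Sum>b. Poly_Mapping.lookup q (?F b) when ?F e = ?F a + ?F b))"
  proof -
    have "(\<Sum>b. Poly_Mapping.lookup q b when ?F e = ?F a + b) =
      (\<Sum>b. Poly_Mapping.lookup q (?F b) when ?F e = ?F a + ?F b)" for a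
      by (rule Sum_any.reindex_cong[OF F]) (simp add: fun_eq_iff)
    then show ?thesis by simp
  qed
  also have "\<dots> = Poly_Mapping.lookup (rename_vars \<sigma> p * rename_vars \<sigma> q) e"
    unfolding index lookup[symmetric] by (rule lookup_mult[symmetric])
  finally show "Poly_Mapping.lookup (rename_vars \<sigma> (p * q)) e =
    Poly_Mapping.lookup (rename_vars \<sigma> p * rename_vars \<sigma> q) e"
    unfolding lookup .
qed

lemma rename_vars_monomial:
  assumes "bij \<sigma>"
  shows "rename_vars \<sigma> (monomial (Poly_Mapping.map_key \<sigma> e)) = monomial e"
  unfolding rename_vars_def monomial_def
  by (rule map_key_single) (intro bij_is_inj bij_map_key assms)

lemma rename_vars_sqf_monomial:
  assumes \<sigma>: "bij \<sigma>"
  shows "rename_vars \<sigma> (monomial (sqf_exp A)) = monomial (sqf_exp (\<sigma> ` A))"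
proof -
  have "Poly_Mapping.map_key \<sigma> (sqf_exp (\<sigma> ` A)) = sqf_exp A"
    using bij_is_inj[OF \<sigma>]
    by (intro poly_mapping_eqI) (simp add: map_key.rep_eq lookup_sqf_exp inj_image_mem_iff)
  then show ?thesis using rename_vars_monomial[OF \<sigma>, of "sqf_exp (\<sigma> ` A)"] by simp
qed

lemma rename_vars_ring_iso:
  fixes \<sigma> :: "'n::finite \<Rightarrow> 'n"
  assumes \<sigma>: "bij \<sigma>"
  shows "(rename_vars \<sigma> :: ('n, 'k::field) mpoly \<Rightarrow> _) \<in> ring_iso mpoly_ring mpoly_ring"
proof (rule ring_iso_memI)
  have "monomial (sqf_exp {}) = (1 :: ('n, 'k) mpoly)"
    using prod_Var[of "{}"] by simp
  then show "rename_vars \<sigma> \<one>\<^bsub>mpoly_ring\<^esub> = (\<one>\<^bsub>mpoly_ring\<^esub> :: ('n, 'k) mpoly)"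
    using rename_vars_sqf_monomial[OF \<sigma>, of "{}", where ?'b = 'k] by simp
qed (use bij_rename_vars[OF \<sigma>] in \<open>simp_all add: rename_vars_add[OF \<sigma>] rename_vars_mult[OF \<sigma>]\<close>)


section \<open>Permuted square-free monomial ideals\<close>

text \<open>
  Images of an antichain under the bijection \<open>\<sigma>\<close> again form an antichain, so the images of the
  minimal generators are the minimal generators of the image ideal. This is the defining property
  of \<open>\<sigma>(I)\<close>.
\<close>

lemma perm_ideal_eq_image:
  fixes I :: "('n::finite, 'k::field) mpoly set"
  assumes I: "squarefree_monomial_ideal I" and \<sigma>: "\<sigma> permutes V"
  shows "perm_ideal \<sigma> I = rename_vars \<sigma> ` I"
proof -
  have bij: "bij \<sigma>" using \<sigma> by (rule permutes_bij)
  note inj = bij_is_inj[OF bij]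
  have ring: "ring (mpoly_ring :: ('n, 'k) mpoly ring)"
    using cring_mpoly_ring by (rule cring.axioms(1))
  obtain \<A> where A: "I = genideal mpoly_ring (monomial ` sqf_exp ` \<A>)"
    "mingens I = monomial ` sqf_exp ` \<A>" "\<And>A B. A \<in> \<A> \<Longrightarrow> B \<in> \<A> \<Longrightarrow> A \<subseteq> B \<Longrightarrow> A = B"
    using squarefree_monomial_idealE[OF I] by metis
  let ?\<B> = "image \<sigma> ` \<A>"
  have image: "rename_vars \<sigma> ` I = genideal mpoly_ring (monomial ` sqf_exp ` ?\<B>)"
    unfolding A(1)
    by (subst image_genideal_ring_iso[OF ring ring rename_vars_ring_iso[OF bij]])
      (simp_all add: image_image rename_vars_sqf_monomial[OF bij])
  have mingens_image: "mingens (rename_vars \<sigma> ` I) = monomial ` sqf_exp ` ?\<B>"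
    unfolding image
  proof (rule mingens_antichain)
    fix B C assume BC: "B \<in> ?\<B>" "C \<in> ?\<B>" "B \<subseteq> C"
    then obtain B' C' where *: "B' \<in> \<A>" "B = \<sigma> ` B'" "C' \<in> \<A>" "C = \<sigma> ` C'" by blast
    then have "B' \<subseteq> C'" using BC(3) inj_image_subset_iff[OF inj] by simp
    then show "B = C" using A(3) * by blast
  qed
  have mem: "(monomial (sqf_exp A) :: ('n, 'k) mpoly) \<in> monomial ` sqf_exp ` \<C> \<longleftrightarrow> A \<in> \<C>" for A \<C>
    by (auto simp: image_iff)
  show ?thesis
    unfolding perm_ideal_def
  proof (rule the1_equality[OF ex1_perm_ideal[OF I \<sigma>]], intro conjI allI)
    show "squarefree_monomial_ideal (rename_vars \<sigma> ` I)"
      unfolding image squarefree_monomial_ideal_def prod_Var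
      by (rule exI[of _ "monomial ` sqf_exp ` ?\<B>"]) auto
    show "(\<Prod>i\<in>A. Var i) \<in> mingens I \<longleftrightarrow> (\<Prod>i\<in>A. Var (\<sigma> i)) \<in> mingens (rename_vars \<sigma> ` I)" for A
      unfolding prod_Var prod_Var_permuted[OF inj] A(2) mingens_image mem
      by (auto simp: image_iff inj_image_eq_iff[OF inj])
  qed
qed

theorem proposition5p9:
  fixes I J :: "('n::finite, 'k::field) mpoly set" and \<sigma> :: "'n \<Rightarrow> 'n"
  assumes "squarefree_monomial_ideal I"
    and "\<sigma> permutes supp I"
    and "squarefree_monomial_ideal J"
  shows "demotion mpoly_ring J I \<longleftrightarrow> demotion mpoly_ring (perm_ideal \<sigma> J) (perm_ideal \<sigma> I)"
proof -
  have ring: "ring (mpoly_ring :: ('n, 'k) mpoly ring)"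
    using cring_mpoly_ring by (rule cring.axioms(1))
  show ?thesis
    unfolding perm_ideal_eq_image[OF assms(1,2)] perm_ideal_eq_image[OF assms(3,2)]
    by (rule demotion_ring_iso_iff[OF ring ring rename_vars_ring_iso[OF permutes_bij[OF assms(2)]]])
      simp_all
qed

end
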